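(* Let $X$ be a compact Hausdorff space, let $A$ be a commutative Banach algebra, and let $\tau : C(X,A)\to C(X,A)$ be a continuous algebra homomorphism with dense range. For $x\in X$ let $T_x:C(X,A)\to A$ be $T_x(f)=f(x)$, and let $\tilde{\tau}_x:A\to A$ be the continuous homomorphism $\tilde{\tau}_x(a):=T_x(\tau(1_a))$, where $1_a\in C(X,A)$ is the constant function with value $a$. Suppose that $T_{x_0}\tau=\tilde{\tau}_{x_0}T_{x_0}$ for some $x_0\in X$. If $C(X,A)$ is $\tau$-weakly amenable, then $A$ is $\tilde{\tau}_{x_0}$-weakly amenable.
   Context: $C(X,A)$ denotes the Banach algebra of all continuous functions $X\to A$ with pointwise operations and norm $\|f\|_\infty=\sup_{x\in X}\|f(x)\|$. Let $B$ be a Banach algebra, $\theta:B\to B$ a continuous homomorphism and $E$ a Banach $B$-bimodule. A $\theta$-derivation is a bounded linear map $D:B\to E$ with $D(ab)=D(a)\cdot\theta(b)+\theta(a)\cdot D(b)$ for all $a,b\in B$. It is $\theta$-inner if there is $x\in E$ with $D(a)=\theta(a)\cdot x-x\cdot\theta(a)$ for all $a\in B$. $B$ is $\theta$-weakly amenable if every $\theta$-derivation $D:B\to B^*$ is $\theta$-inner, where $B^*$ carries the usual dual bimodule structure. *)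

theory Defs
  imports "HOL-Analysis.Analysis"
begin

section \<open>Complex Banach spaces and Banach algebras\<close>

text \<open>The distribution has only real normed spaces and algebras. The classes below add a complex
  scalar multiplication that extends the real one. Algebras are neither assumed to be unital nor
  commutative.\<close>

class complex_normed_vector = real_normed_vector +
  fixes scaleC :: "complex \<Rightarrow> 'a \<Rightarrow> 'a" (infixr "*\<^sub>C" 75)
  assumes scaleC_add_right: "c *\<^sub>C (x + y) = c *\<^sub>C x + c *\<^sub>C y"
    and scaleC_add_left: "(c + d) *\<^sub>C x = c *\<^sub>C x + d *\<^sub>C x"
    and scaleC_scaleC: "c *\<^sub>C d *\<^sub>C x = (c * d) *\<^sub>C x"
    and scaleC_of_real: "complex_of_real t *\<^sub>C x = t *\<^sub>R x"
    and norm_scaleC: "norm (c *\<^sub>C x) = cmod c * norm x"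

class complex_banach = complex_normed_vector + complete_space
begin
subclass banach ..
end

class complex_normed_algebra = complex_normed_vector + real_normed_algebra +
  assumes mult_scaleC_left: "(c *\<^sub>C x) * y = c *\<^sub>C (x * y)"
    and mult_scaleC_right: "x * (c *\<^sub>C y) = c *\<^sub>C (x * y)"

class complex_banach_algebra = complex_normed_algebra + complete_space
begin
subclass complex_banach ..
end

instantiation complex :: complex_banach_algebra
begin

definition scaleC_complex :: "complex \<Rightarrow> complex \<Rightarrow> complex"
  where "scaleC_complex c z = c * z"

instance
  by standard (simp_all add: scaleC_complex_def algebra_simps norm_mult scaleR_conv_of_real)

end

definition complex_linear ::
    "('a::complex_normed_vector \<Rightarrow> 'b::complex_normed_vector) \<Rightarrow> bool"
  where "complex_linear f \<longleftrightarrow>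
    (\<forall>x y. f (x + y) = f x + f y) \<and> (\<forall>c x. f (c *\<^sub>C x) = c *\<^sub>C f x)"

definition bounded_complex_linear ::
    "('a::complex_normed_vector \<Rightarrow> 'b::complex_normed_vector) \<Rightarrow> bool"
  where "bounded_complex_linear f \<longleftrightarrow>
    complex_linear f \<and> (\<exists>K. \<forall>x. norm (f x) \<le> K * norm x)"

definition algebra_hom ::
    "('a::complex_normed_algebra \<Rightarrow> 'b::complex_normed_algebra) \<Rightarrow> bool"
  where "algebra_hom f \<longleftrightarrow> complex_linear f \<and> (\<forall>x y. f (x * y) = f x * f y)"

lemma complex_linear_scaleR:
  assumes "complex_linear f" shows "f (t *\<^sub>R x) = t *\<^sub>R f x"
  using assms by (metis complex_linear_def scaleC_of_real)

lemma bounded_complex_linear_iff: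
  "bounded_complex_linear f \<longleftrightarrow> bounded_linear f \<and> (\<forall>c x. f (c *\<^sub>C x) = c *\<^sub>C f x)"
proof
  assume f: "bounded_complex_linear f"
  then obtain K where K: "\<And>x. norm (f x) \<le> K * norm x"
    by (auto simp: bounded_complex_linear_def)
  have l: "complex_linear f"
    using f by (simp add: bounded_complex_linear_def)
  have "bounded_linear f"
    by (rule bounded_linear_intro[where K = K])
      (use l K in \<open>auto simp: complex_linear_scaleR mult.commute, simp add: complex_linear_def\<close>)
  then show "bounded_linear f \<and> (\<forall>c x. f (c *\<^sub>C x) = c *\<^sub>C f x)"
    using l by (simp add: complex_linear_def)
next
  assume f: "bounded_linear f \<and> (\<forall>c x. f (c *\<^sub>C x) = c *\<^sub>C f x)"
  then obtain K where "\<And>x. norm (f x) \<le> norm x * K"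
    using bounded_linear.bounded by blast
  then show "bounded_complex_linear f"
    using f unfolding bounded_complex_linear_def complex_linear_def
    by (metis bounded_linear.linear linear_add mult.commute)
qed

section \<open>The Banach algebra of continuous functions on a compact space\<close>

text \<open>For a compact space \<open>X\<close> every continuous function is bounded, so that the library type of
  bounded continuous functions, which carries the supremum norm, is \<open>C(X,A)\<close>.\<close>

lemma compact_bcontfun_eq:
  assumes "compact (UNIV :: 'x::topological_space set)"
  shows "range (apply_bcontfun :: ('x \<Rightarrow>\<^sub>C 'a::metric_space) \<Rightarrow> _) = {f. continuous_on UNIV f}"
proof -
  have "range (apply_bcontfun :: ('x \<Rightarrow>\<^sub>C 'a) \<Rightarrow> _) = bcontfun"
    using type_definition_bcontfun by (rule type_definition.Rep_range)
  also have "\<dots> = {f. continuous_on UNIV f}"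
    unfolding bcontfun_def
    by (auto intro: compact_imp_bounded compact_continuous_image[OF _ assms])
  finally show ?thesis .
qed

lemma norm_bcontfun_eq_SUP: "norm f = (SUP x. norm (apply_bcontfun f x))"
proof (rule antisym)
  have "bdd_above (range (\<lambda>x. norm (apply_bcontfun f x)))"
    using norm_bounded[of f] by (auto intro!: bdd_aboveI)
  then show "norm f \<le> (SUP x. norm (apply_bcontfun f x))"
    by (intro norm_bound cSUP_upper) auto
  show "(SUP x. norm (apply_bcontfun f x)) \<le> norm f"
    by (intro cSUP_least norm_bounded) auto
qed

text \<open>The library proves completeness only for functions on a metric space.\<close>

instance bcontfun :: (topological_space, complete_space) complete_space
proof
  fix f :: "nat \<Rightarrow> ('a, 'b) bcontfun"
  assume "Cauchy f"
  then obtain g where "uniform_limit UNIV f g sequentially"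
    using uniformly_convergent_eq_cauchy[of "\<lambda>_. True" f]
    unfolding Cauchy_def uniform_limit_sequentially_iff
    by (metis dist_fun_lt_imp_dist_val_lt)
  from uniform_limit_bcontfunE[OF this sequentially_bot]
  obtain l' where "g = apply_bcontfun l'" "(f \<longlonglongrightarrow> l')" by metis
  then show "convergent f"
    by (intro convergentI)
qed

instantiation bcontfun :: (topological_space, complex_normed_vector) complex_normed_vector
begin

definition scaleC_bcontfun :: "complex \<Rightarrow> ('a \<Rightarrow>\<^sub>C 'b) \<Rightarrow> ('a \<Rightarrow>\<^sub>C 'b)"
  where "scaleC_bcontfun c f = Bcontfun (\<lambda>x. c *\<^sub>C apply_bcontfun f x)"

lemma apply_bcontfun_scaleC [simp]:
  "apply_bcontfun (c *\<^sub>C f) x = c *\<^sub>C apply_bcontfun f x" for f :: "'a \<Rightarrow>\<^sub>C 'b"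
proof -
  have "bounded_linear (\<lambda>y::'b. c *\<^sub>C y)"
    by (rule bounded_linear_intro[where K = "cmod c"])
      (simp_all add: scaleC_add_right norm_scaleC mult.commute scaleC_scaleC
        flip: scaleC_of_real)
  then have "continuous_on UNIV (\<lambda>x. c *\<^sub>C apply_bcontfun f x)"
    by (rule bounded_linear.continuous_on) simp
  then have "(\<lambda>x. c *\<^sub>C apply_bcontfun f x) \<in> bcontfun"
    by (rule bcontfun_normI[where b = "cmod c * norm f"])
      (simp add: norm_scaleC norm_bounded mult_left_mono)
  then show ?thesis
    by (simp add: scaleC_bcontfun_def Bcontfun_inverse)
qed

instance
proof
  fix c d :: complex and t :: real and f g :: "'a \<Rightarrow>\<^sub>C 'b"
  show "c *\<^sub>C (f + g) = c *\<^sub>C f + c *\<^sub>C g"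
    by (rule bcontfun_eqI) (simp add: scaleC_add_right)
  show "(c + d) *\<^sub>C f = c *\<^sub>C f + d *\<^sub>C f"
    by (rule bcontfun_eqI) (simp add: scaleC_add_left)
  show "c *\<^sub>C d *\<^sub>C f = (c * d) *\<^sub>C f"
    by (rule bcontfun_eqI) (simp add: scaleC_scaleC)
  show "complex_of_real t *\<^sub>C f = t *\<^sub>R f"
    by (rule bcontfun_eqI) (simp add: scaleC_of_real)
  have le: "norm (c *\<^sub>C f) \<le> cmod c * norm f" for c and f :: "'a \<Rightarrow>\<^sub>C 'b"
    by (rule norm_bound) (simp add: norm_scaleC norm_bounded mult_left_mono)
  show "norm (c *\<^sub>C f) = cmod c * norm f"
  proof (cases "c = 0")
    case True
    then show ?thesis using le[of c f] by simp
  next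
    case False
    have "inverse c *\<^sub>C c *\<^sub>C f = f"
      by (rule bcontfun_eqI)
        (use False in \<open>simp add: scaleC_scaleC scaleC_of_real[of 1, simplified]\<close>)
    then have "norm f \<le> inverse (cmod c) * norm (c *\<^sub>C f)"
      using le[of "inverse c" "c *\<^sub>C f"] by (simp add: norm_inverse)
    then have "cmod c * norm f \<le> norm (c *\<^sub>C f)"
      using False by (simp add: field_simps)
    then show ?thesis using le[of c f] by simp
  qed
qed

end

instantiation bcontfun :: (topological_space, real_normed_algebra) real_normed_algebra
begin

definition times_bcontfun :: "('a \<Rightarrow>\<^sub>C 'b) \<Rightarrow> ('a \<Rightarrow>\<^sub>C 'b) \<Rightarrow> ('a \<Rightarrow>\<^sub>C 'b)"
  where "times_bcontfun f g = Bcontfun (\<lambda>x. apply_bcontfun f x * apply_bcontfun g x)"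

lemma norm_apply_bcontfun_mult_le:
  "norm (apply_bcontfun f x * apply_bcontfun g x) \<le> norm f * norm g" for f g :: "'a \<Rightarrow>\<^sub>C 'b"
  by (rule order_trans[OF norm_mult_ineq]) (simp add: mult_mono norm_bounded)

lemma apply_bcontfun_mult [simp]:
  "apply_bcontfun (f * g) x = apply_bcontfun f x * apply_bcontfun g x" for f g :: "'a \<Rightarrow>\<^sub>C 'b"
proof -
  have "(\<lambda>x. apply_bcontfun f x * apply_bcontfun g x) \<in> bcontfun"
    by (rule bcontfun_normI[where b = "norm f * norm g"])
      (auto intro!: continuous_intros norm_apply_bcontfun_mult_le)
  then show ?thesis
    by (simp add: times_bcontfun_def Bcontfun_inverse)
qed

instance
proof
  fix f g :: "'a \<Rightarrow>\<^sub>C 'b"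
  show "norm (f * g) \<le> norm f * norm g"
    by (rule norm_bound) (simp add: norm_apply_bcontfun_mult_le)
qed (auto intro!: bcontfun_eqI simp: algebra_simps)

end

instance bcontfun :: (topological_space, "{comm_ring, real_normed_algebra}") comm_ring
  by standard (auto intro!: bcontfun_eqI simp: algebra_simps)

instance bcontfun :: (topological_space, complex_normed_algebra) complex_normed_algebra
  by standard (auto intro!: bcontfun_eqI simp: mult_scaleC_left mult_scaleC_right)

instance bcontfun :: (topological_space, complex_banach_algebra) complex_banach_algebra ..

section \<open>The dual space\<close>

text \<open>The complex-linear functionals inside the library's space of bounded real-linear maps into
  the complex numbers; the norm is the operator norm.\<close>

typedef (overloaded) 'a dual =
    "{\<phi> :: 'a::complex_normed_vector \<Rightarrow>\<^sub>L complex. bounded_complex_linear (blinfun_apply \<phi>)}"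
  morphisms blinfun_of_dual Abs_dual
  by (rule exI[of _ 0]) (simp add: bounded_complex_linear_iff scaleC_complex_def blinfun.bounded_linear_right)

setup_lifting type_definition_dual

definition dual_apply :: "'a::complex_normed_vector dual \<Rightarrow> 'a \<Rightarrow> complex"
  where "dual_apply \<phi> = blinfun_apply (blinfun_of_dual \<phi>)"

lemma in_dual_iff:
  "bounded_complex_linear (blinfun_apply \<phi>) \<longleftrightarrow>
    (\<forall>c x. blinfun_apply \<phi> (c *\<^sub>C x) = c * blinfun_apply \<phi> x)"
  by (simp add: bounded_complex_linear_iff scaleC_complex_def blinfun.bounded_linear_right)

lemma bounded_complex_linear_dual_apply: "bounded_complex_linear (dual_apply \<phi>)"
  using blinfun_of_dual[of \<phi>] by (simp add: dual_apply_def)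

lemma dual_eqI: "(\<And>x. dual_apply \<phi> x = dual_apply \<psi> x) \<Longrightarrow> \<phi> = \<psi>"
  by (simp add: dual_apply_def blinfun_of_dual_inject[symmetric] blinfun_eqI)

instantiation dual :: (complex_normed_vector) complex_normed_vector
begin

lift_definition zero_dual :: "'a dual" is 0
  by (simp add: in_dual_iff)

lift_definition plus_dual :: "'a dual \<Rightarrow> 'a dual \<Rightarrow> 'a dual" is "(+)"
  by (simp add: in_dual_iff blinfun.bilinear_simps algebra_simps)

lift_definition minus_dual :: "'a dual \<Rightarrow> 'a dual \<Rightarrow> 'a dual" is "(-)"
  by (simp add: in_dual_iff blinfun.bilinear_simps algebra_simps)

lift_definition uminus_dual :: "'a dual \<Rightarrow> 'a dual" is uminus
  by (simp add: in_dual_iff blinfun.bilinear_simps algebra_simps)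

lift_definition scaleR_dual :: "real \<Rightarrow> 'a dual \<Rightarrow> 'a dual" is "(*\<^sub>R)"
  by (simp add: in_dual_iff blinfun.bilinear_simps algebra_simps)

lift_definition scaleC_dual :: "complex \<Rightarrow> 'a dual \<Rightarrow> 'a dual"
  is "\<lambda>c \<phi>. blinfun_compose (Blinfun (\<lambda>z. c * z)) \<phi>"
  by (simp add: in_dual_iff bounded_linear_Blinfun_apply bounded_linear_mult_right algebra_simps)

lift_definition norm_dual :: "'a dual \<Rightarrow> real" is norm .

definition dist_dual :: "'a dual \<Rightarrow> 'a dual \<Rightarrow> real"
  where "dist_dual \<phi> \<psi> = norm (\<phi> - \<psi>)"

definition sgn_dual :: "'a dual \<Rightarrow> 'a dual"
  where "sgn_dual \<phi> = scaleR (inverse (norm \<phi>)) \<phi>"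

definition uniformity_dual :: "('a dual \<times> 'a dual) filter"
  where "uniformity_dual = (INF e\<in>{0 <..}. principal {(x, y). dist x y < e})"

definition open_dual :: "'a dual set \<Rightarrow> bool"
  where "open_dual S = (\<forall>x\<in>S. \<forall>\<^sub>F (x', y) in uniformity. x' = x \<longrightarrow> y \<in> S)"

lemma dual_apply_scaleC_aux:
  "blinfun_apply (blinfun_compose (Blinfun (\<lambda>z. c * z)) \<phi>) x = c * blinfun_apply \<phi> x"
  for c :: complex
  by (simp add: bounded_linear_Blinfun_apply bounded_linear_mult_right)

lemma norm_dual_scaleC_aux:
  "norm (blinfun_compose (Blinfun (\<lambda>z. c * z)) \<phi>) = cmod c * norm \<phi>"
  for \<phi> :: "'a \<Rightarrow>\<^sub>L complex"
proof -
  have le: "norm (blinfun_compose (Blinfun (\<lambda>z. c * z)) \<phi>) \<le> cmod c * norm \<phi>"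
    for c and \<phi> :: "'a \<Rightarrow>\<^sub>L complex"
  proof (rule norm_blinfun_bound)
    fix x
    show "cmod (blinfun_apply (blinfun_compose (Blinfun (\<lambda>z. c * z)) \<phi>) x)
        \<le> cmod c * norm \<phi> * norm x"
      using mult_left_mono[OF norm_blinfun[of \<phi> x] norm_ge_zero[of c]]
      by (simp only: dual_apply_scaleC_aux norm_mult mult.assoc)
  qed simp
  show ?thesis
  proof (cases "c = 0")
    case True
    then show ?thesis using le[of c \<phi>] by simp
  next
    case False
    let ?\<psi> = "blinfun_compose (Blinfun (\<lambda>z. c * z)) \<phi>"
    have "blinfun_compose (Blinfun (\<lambda>z. inverse c * z)) ?\<psi> = \<phi>"
      by (rule blinfun_eqI) (use False in \<open>simp only: dual_apply_scaleC_aux, simp\<close>)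
    then have "norm \<phi> \<le> inverse (cmod c) * norm ?\<psi>"
      using le[of "inverse c" ?\<psi>] by (simp add: norm_inverse)
    then have "cmod c * norm \<phi> \<le> norm ?\<psi>"
      using False by (simp add: field_simps)
    then show ?thesis using le[of c \<phi>] by simp
  qed
qed

instance
proof
  fix a b c :: "'a dual" and t u :: real and z w :: complex
  show "a + b + c = a + (b + c)" by transfer (simp add: algebra_simps)
  show "a + b = b + a" by transfer (simp add: algebra_simps)
  show "0 + a = a" by transfer simp
  show "- a + a = 0" by transfer simp
  show "a - b = a + - b" by transfer simp
  show "t *\<^sub>R (a + b) = t *\<^sub>R a + t *\<^sub>R b" by transfer (simp add: algebra_simps)
  show "(t + u) *\<^sub>R a = t *\<^sub>R a + u *\<^sub>R a" by transfer (simp add: algebra_simps)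
  show "t *\<^sub>R u *\<^sub>R a = (t * u) *\<^sub>R a" by transfer simp
  show "1 *\<^sub>R a = a" by transfer simp
  show "dist a b = norm (a - b)" by (rule dist_dual_def)
  show "sgn a = scaleR (inverse (norm a)) a" by (rule sgn_dual_def)
  show "uniformity = (INF e\<in>{0 <..}. principal {(x::'a dual, y). dist x y < e})"
    by (rule uniformity_dual_def)
  show "open S \<longleftrightarrow> (\<forall>x\<in>S. \<forall>\<^sub>F (x', y) in uniformity. x' = x \<longrightarrow> y \<in> S)" for S :: "'a dual set"
    by (rule open_dual_def)
  show "norm a = 0 \<longleftrightarrow> a = 0" by transfer simp
  show "norm (a + b) \<le> norm a + norm b" by transfer (rule norm_triangle_ineq)
  show "norm (t *\<^sub>R a) = \<bar>t\<bar> * norm a" by transfer simp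
  show "z *\<^sub>C (a + b) = z *\<^sub>C a + z *\<^sub>C b"
    by transfer (rule blinfun_eqI, simp only: dual_apply_scaleC_aux blinfun.add_left distrib_left)
  show "(z + w) *\<^sub>C a = z *\<^sub>C a + w *\<^sub>C a"
    by transfer (rule blinfun_eqI, simp only: dual_apply_scaleC_aux blinfun.add_left distrib_right)
  show "z *\<^sub>C w *\<^sub>C a = (z * w) *\<^sub>C a"
    by transfer (rule blinfun_eqI, simp only: dual_apply_scaleC_aux mult.assoc)
  show "complex_of_real t *\<^sub>C a = t *\<^sub>R a"
    by transfer (rule blinfun_eqI,
      simp only: dual_apply_scaleC_aux blinfun.scaleR_left scaleR_conv_of_real)
  show "norm (z *\<^sub>C a) = cmod z * norm a"
    by transfer (rule norm_dual_scaleC_aux)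
qed

end

lemma dual_apply_simps [simp]:
  "dual_apply 0 x = 0"
  "dual_apply (\<phi> + \<psi>) x = dual_apply \<phi> x + dual_apply \<psi> x"
  "dual_apply (\<phi> - \<psi>) x = dual_apply \<phi> x - dual_apply \<psi> x"
  "dual_apply (- \<phi>) x = - dual_apply \<phi> x"
  "dual_apply (c *\<^sub>C \<phi>) x = c * dual_apply \<phi> x"
  by (simp_all only: dual_apply_def zero_dual.rep_eq plus_dual.rep_eq minus_dual.rep_eq
      uminus_dual.rep_eq scaleC_dual.rep_eq dual_apply_scaleC_aux blinfun.bilinear_simps)

lemma norm_dual_apply_le: "norm (dual_apply \<phi> x) \<le> norm \<phi> * norm x"
  by (simp add: dual_apply_def norm_dual.rep_eq norm_blinfun)

instance dual :: (complex_normed_vector) complex_banach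
proof
  fix X :: "nat \<Rightarrow> 'a dual"
  assume "Cauchy X"
  have dist: "dist \<phi> \<psi> = dist (blinfun_of_dual \<phi>) (blinfun_of_dual \<psi>)" for \<phi> \<psi> :: "'a dual"
    by (simp add: dist_norm norm_dual.rep_eq minus_dual.rep_eq)
  have "Cauchy (\<lambda>n. blinfun_of_dual (X n))"
    using \<open>Cauchy X\<close> by (simp add: Cauchy_def dist)
  then obtain \<phi> where \<phi>: "(\<lambda>n. blinfun_of_dual (X n)) \<longlonglongrightarrow> \<phi>"
    by (metis Cauchy_convergent convergent_def)
  have lim: "(\<lambda>n. dual_apply (X n) x) \<longlonglongrightarrow> blinfun_apply \<phi> x" for x
    unfolding dual_apply_def by (intro tendsto_intros \<phi>)
  have "blinfun_apply \<phi> (c *\<^sub>C x) = c * blinfun_apply \<phi> x" for c x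
  proof (rule LIMSEQ_unique[OF lim])
    have "dual_apply (X n) (c *\<^sub>C x) = c * dual_apply (X n) x" for n
      using bounded_complex_linear_dual_apply[of "X n"]
      by (simp add: bounded_complex_linear_iff scaleC_complex_def)
    then show "(\<lambda>n. dual_apply (X n) (c *\<^sub>C x)) \<longlonglongrightarrow> c * blinfun_apply \<phi> x"
      using tendsto_mult_left[OF lim[of x], of c] by simp
  qed
  then have "blinfun_of_dual (Abs_dual \<phi>) = \<phi>"
    by (simp add: Abs_dual_inverse in_dual_iff)
  then have "X \<longlonglongrightarrow> Abs_dual \<phi>"
    using \<phi> by (simp add: lim_sequentially dist)
  then show "convergent X"
    by (rule convergentI)
qed

section \<open>Bimodules, derivations and weak amenability\<close>

locale banach_bimodule =
  fixes l :: "'b::complex_banach_algebra \<Rightarrow> 'e::complex_banach \<Rightarrow> 'e"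
    and r :: "'e \<Rightarrow> 'b \<Rightarrow> 'e"
  assumes left_bilinear: "bounded_bilinear l"
    and right_bilinear: "bounded_bilinear r"
    and left_scaleC: "l (c *\<^sub>C a) x = c *\<^sub>C l a x" "l a (c *\<^sub>C x) = c *\<^sub>C l a x"
    and right_scaleC: "r (c *\<^sub>C x) a = c *\<^sub>C r x a" "r x (c *\<^sub>C a) = c *\<^sub>C r x a"
    and left_assoc: "l (a * b) x = l a (l b x)"
    and right_assoc: "r x (a * b) = r (r x a) b"
    and left_right_assoc: "r (l a x) b = l a (r x b)"

definition theta_derivation ::
    "('b::complex_banach_algebra \<Rightarrow> 'e::complex_banach \<Rightarrow> 'e) \<Rightarrow> ('e \<Rightarrow> 'b \<Rightarrow> 'e) \<Rightarrow>
      ('b \<Rightarrow> 'b) \<Rightarrow> ('b \<Rightarrow> 'e) \<Rightarrow> bool"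
  where "theta_derivation l r \<theta> D \<longleftrightarrow>
    bounded_complex_linear D \<and> (\<forall>a b. D (a * b) = r (D a) (\<theta> b) + l (\<theta> a) (D b))"

definition theta_inner ::
    "('b::complex_banach_algebra \<Rightarrow> 'e::complex_banach \<Rightarrow> 'e) \<Rightarrow> ('e \<Rightarrow> 'b \<Rightarrow> 'e) \<Rightarrow>
      ('b \<Rightarrow> 'b) \<Rightarrow> ('b \<Rightarrow> 'e) \<Rightarrow> bool"
  where "theta_inner l r \<theta> D \<longleftrightarrow> (\<exists>x. \<forall>a. D a = l (\<theta> a) x - r x (\<theta> a))"

lift_definition dual_left :: "'b::complex_banach_algebra \<Rightarrow> 'b dual \<Rightarrow> 'b dual"
  is "\<lambda>a \<phi>. blinfun_compose \<phi> (Blinfun (\<lambda>b. b * a))"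
  by (simp add: in_dual_iff bounded_linear_Blinfun_apply bounded_linear_mult_left mult_scaleC_left)

lift_definition dual_right :: "'b::complex_banach_algebra dual \<Rightarrow> 'b \<Rightarrow> 'b dual"
  is "\<lambda>\<phi> a. blinfun_compose \<phi> (Blinfun (\<lambda>b. a * b))"
  by (simp add: in_dual_iff bounded_linear_Blinfun_apply bounded_linear_mult_right mult_scaleC_right)

lemma dual_left_apply [simp]: "dual_apply (dual_left a \<phi>) b = dual_apply \<phi> (b * a)"
  by (simp add: dual_apply_def dual_left.rep_eq bounded_linear_Blinfun_apply
      bounded_linear_mult_left)

lemma dual_right_apply [simp]: "dual_apply (dual_right \<phi> a) b = dual_apply \<phi> (a * b)"
  by (simp add: dual_apply_def dual_right.rep_eq bounded_linear_Blinfun_apply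
      bounded_linear_mult_right)

lemma dual_apply_linear [simp]:
  "dual_apply \<phi> (x + y) = dual_apply \<phi> x + dual_apply \<phi> y"
  "dual_apply \<phi> (c *\<^sub>C x) = c * dual_apply \<phi> x"
  using bounded_complex_linear_dual_apply[of \<phi>]
  by (simp_all add: bounded_complex_linear_def complex_linear_def scaleC_complex_def)

lemma norm_dual_bound:
  "0 \<le> K \<Longrightarrow> (\<And>x. norm (dual_apply \<phi> x) \<le> K * norm x) \<Longrightarrow> norm \<phi> \<le> K"
  by (simp add: dual_apply_def norm_dual.rep_eq norm_blinfun_bound)

interpretation dual_bimodule: banach_bimodule dual_left dual_right
proof
  fix a b :: "'b::complex_banach_algebra" and \<phi> \<psi> :: "'b dual" and c :: complex and t :: real
  show "dual_left (a + b) \<phi> = dual_left a \<phi> + dual_left b \<phi>"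
    "dual_left a (\<phi> + \<psi>) = dual_left a \<phi> + dual_left a \<psi>"
    "dual_right (\<phi> + \<psi>) a = dual_right \<phi> a + dual_right \<psi> a"
    "dual_right \<phi> (a + b) = dual_right \<phi> a + dual_right \<phi> b"
    by (rule dual_eqI; simp add: algebra_simps)+
  show cl: "dual_left (c *\<^sub>C a) \<phi> = c *\<^sub>C dual_left a \<phi>"
    "dual_left a (c *\<^sub>C \<phi>) = c *\<^sub>C dual_left a \<phi>"
    "dual_right (c *\<^sub>C \<phi>) a = c *\<^sub>C dual_right \<phi> a"
    "dual_right \<phi> (c *\<^sub>C a) = c *\<^sub>C dual_right \<phi> a" for c
    by (rule dual_eqI; simp add: mult_scaleC_left mult_scaleC_right)+
  show "dual_left (t *\<^sub>R a) \<phi> = t *\<^sub>R dual_left a \<phi>"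
    "dual_left a (t *\<^sub>R \<phi>) = t *\<^sub>R dual_left a \<phi>"
    "dual_right (t *\<^sub>R \<phi>) a = t *\<^sub>R dual_right \<phi> a"
    "dual_right \<phi> (t *\<^sub>R a) = t *\<^sub>R dual_right \<phi> a"
    by (simp_all add: cl flip: scaleC_of_real)
  show "dual_left (a * b) \<phi> = dual_left a (dual_left b \<phi>)"
    "dual_right \<phi> (a * b) = dual_right (dual_right \<phi> a) b"
    "dual_right (dual_left a \<phi>) b = dual_left a (dual_right \<phi> b)"
    by (rule dual_eqI; simp add: mult.assoc)+
next
  have "norm (dual_left a \<phi>) \<le> norm a * norm \<phi>" for a :: "'b::complex_banach_algebra" and \<phi>
  proof (rule norm_dual_bound)
    fix b
    have "norm (dual_apply \<phi> (b * a)) \<le> norm \<phi> * norm (b * a)"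
      by (rule norm_dual_apply_le)
    also have "\<dots> \<le> norm \<phi> * (norm b * norm a)"
      by (intro mult_left_mono norm_mult_ineq norm_ge_zero)
    finally show "norm (dual_apply (dual_left a \<phi>) b) \<le> norm a * norm \<phi> * norm b"
      by (simp add: mult_ac)
  qed simp
  then show "\<exists>K. \<forall>(a::'b::complex_banach_algebra) \<phi>. norm (dual_left a \<phi>) \<le> norm a * norm \<phi> * K"
    by (metis mult.right_neutral)
  have "norm (dual_right \<phi> a) \<le> norm \<phi> * norm a" for a :: "'b::complex_banach_algebra" and \<phi>
  proof (rule norm_dual_bound)
    fix b
    have "norm (dual_apply \<phi> (a * b)) \<le> norm \<phi> * norm (a * b)"
      by (rule norm_dual_apply_le)
    also have "\<dots> \<le> norm \<phi> * (norm a * norm b)"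
      by (intro mult_left_mono norm_mult_ineq norm_ge_zero)
    finally show "norm (dual_apply (dual_right \<phi> a) b) \<le> norm \<phi> * norm a * norm b"
      by (simp add: mult_ac)
  qed simp
  then show "\<exists>K. \<forall>\<phi> (a::'b::complex_banach_algebra). norm (dual_right \<phi> a) \<le> norm \<phi> * norm a * K"
    by (metis mult.right_neutral)
qed

definition theta_weakly_amenable :: "('b::complex_banach_algebra \<Rightarrow> 'b) \<Rightarrow> bool"
  where "theta_weakly_amenable \<theta> \<longleftrightarrow>
    (\<forall>D :: 'b \<Rightarrow> 'b dual.
      theta_derivation dual_left dual_right \<theta> D \<longrightarrow> theta_inner dual_left dual_right \<theta> D)"

section \<open>Point evaluations\<close>

definition eval_at :: "'x::topological_space \<Rightarrow> ('x \<Rightarrow>\<^sub>C 'a::metric_space) \<Rightarrow> 'a"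
  where "eval_at x f = apply_bcontfun f x"

definition tau_tilde ::
    "(('x::topological_space \<Rightarrow>\<^sub>C 'a::metric_space) \<Rightarrow> ('x \<Rightarrow>\<^sub>C 'a)) \<Rightarrow> 'x \<Rightarrow> 'a \<Rightarrow> 'a"
  where "tau_tilde \<tau> x a = eval_at x (\<tau> (const_bcontfun a))"

lemma tau_tilde_continuous_hom:
  fixes \<tau> :: "('x::topological_space \<Rightarrow>\<^sub>C 'a::complex_banach_algebra) \<Rightarrow> ('x \<Rightarrow>\<^sub>C 'a)"
  assumes hom: "algebra_hom \<tau>" and cont: "continuous_on UNIV \<tau>"
  shows "algebra_hom (tau_tilde \<tau> x)" "continuous_on UNIV (tau_tilde \<tau> x)"
proof -
  have c: "const_bcontfun (a + b) = const_bcontfun a + (const_bcontfun b :: 'x \<Rightarrow>\<^sub>C 'a)"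
    "const_bcontfun (a * b) = const_bcontfun a * (const_bcontfun b :: 'x \<Rightarrow>\<^sub>C 'a)"
    "const_bcontfun (z *\<^sub>C a) = z *\<^sub>C (const_bcontfun a :: 'x \<Rightarrow>\<^sub>C 'a)" for a b z
    by (rule bcontfun_eqI; simp)+
  show "algebra_hom (tau_tilde \<tau> x)"
    using hom by (simp add: algebra_hom_def complex_linear_def tau_tilde_def eval_at_def c)
  have 1: "continuous_on UNIV (const_bcontfun :: 'a \<Rightarrow> 'x \<Rightarrow>\<^sub>C 'a)"
    by (rule continuous_onI) (metis const_bcontfun.rep_eq dist_bound less_imp_le)
  have 2: "continuous_on UNIV (\<lambda>f :: 'x \<Rightarrow>\<^sub>C 'a. apply_bcontfun f x)"
    by (rule continuous_onI) (metis dist_bounded le_less_trans less_imp_le)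
  show "continuous_on UNIV (tau_tilde \<tau> x)"
    unfolding tau_tilde_def eval_at_def
    by (rule continuous_on_compose2[OF 2 continuous_on_compose2[OF cont 1]]) auto
qed

end

(* A tau_tilde-derivation D on A pulls back along the evaluation T at x0 to the tau-derivation
   f |-> D (T f) o T on C(X,A), because T intertwines tau and tau_tilde. Inner derivations into the
   dual of a commutative algebra vanish, so the pullback is zero; since T is onto, D is zero. *)
theory Submission
  imports Defs
begin

text \<open>The Banach space adjoint of \<open>T\<close>, totalised: \<open>Blinfun\<close> and
  \<open>Abs_dual\<close> are only known to be inverted when the composite is bounded and complex
  linear, so facts about \<open>dual_map T\<close> assume this of \<open>T\<close>.\<close>

definition dual_map ::
    "('b::complex_normed_vector \<Rightarrow> 'a::complex_normed_vector) \<Rightarrow> 'a dual \<Rightarrow> 'b dual"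
  where "dual_map T \<phi> = Abs_dual (Blinfun (dual_apply \<phi> \<circ> T))"

lemma bounded_complex_linear_compose:
  assumes "bounded_complex_linear f" "bounded_complex_linear g"
  shows "bounded_complex_linear (g \<circ> f)"
  using assms bounded_linear_compose[of g f] by (simp add: bounded_complex_linear_iff o_def)

lemma dual_map_apply [simp]:
  assumes "bounded_complex_linear T"
  shows "dual_apply (dual_map T \<phi>) x = dual_apply \<phi> (T x)"
proof -
  have *: "bounded_complex_linear (dual_apply \<phi> \<circ> T)"
    by (rule bounded_complex_linear_compose[OF assms bounded_complex_linear_dual_apply])
  then have "blinfun_apply (Blinfun (dual_apply \<phi> \<circ> T)) = dual_apply \<phi> \<circ> T"
    by (intro bounded_linear_Blinfun_apply) (simp add: bounded_complex_linear_iff)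
  with * show ?thesis
    by (simp add: dual_map_def dual_apply_def[of "Abs_dual _"] Abs_dual_inverse)
qed

lemma bounded_complex_linear_dual_map:
  assumes T: "bounded_complex_linear T"
  shows "bounded_complex_linear (dual_map T)"
  unfolding bounded_complex_linear_def complex_linear_def
proof (intro conjI allI)
  show "dual_map T (\<phi> + \<psi>) = dual_map T \<phi> + dual_map T \<psi>" for \<phi> \<psi>
    by (rule dual_eqI) (simp add: T)
  show "dual_map T (c *\<^sub>C \<phi>) = c *\<^sub>C dual_map T \<phi>" for c \<phi>
    by (rule dual_eqI) (simp add: T)
  \<comment> \<open>A positive bound is chosen because \<open>norm_dual_bound\<close> requires a
    nonnegative constant.\<close>
  from T obtain K where K: "K > 0" "\<And>x. norm (T x) \<le> norm x * K"
    using bounded_linear.pos_bounded by (metis bounded_complex_linear_iff)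
  have "norm (dual_map T \<phi>) \<le> K * norm \<phi>" for \<phi>
  proof (rule norm_dual_bound)
    fix x
    have "norm (dual_apply \<phi> (T x)) \<le> norm \<phi> * norm (T x)"
      by (rule norm_dual_apply_le)
    also have "\<dots> \<le> norm \<phi> * (norm x * K)"
      by (intro mult_left_mono K norm_ge_zero)
    finally show "norm (dual_apply (dual_map T \<phi>) x) \<le> K * norm \<phi> * norm x"
      by (simp add: T mult_ac)
  qed (use K in simp)
  then show "\<exists>K. \<forall>\<phi>. norm (dual_map T \<phi>) \<le> K * norm \<phi>" by blast
qed

text \<open>Commutativity makes the left and right actions on the dual coincide, so every commutator
  vanishes. Weak amenability thus says that the only derivation into the dual is zero.\<close>

lemma theta_inner_dual_iff_zero:
  fixes D :: "'b::{complex_banach_algebra, comm_ring} \<Rightarrow> 'b dual"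
  shows "theta_inner dual_left dual_right \<theta> D \<longleftrightarrow> (\<forall>a. D a = 0)"
proof -
  have "dual_left a \<phi> - dual_right \<phi> a = 0" for a and \<phi> :: "'b dual"
    by (rule dual_eqI) (simp add: mult.commute)
  then show ?thesis by (simp add: theta_inner_def)
qed

lemma theta_derivation_pullback:
  fixes T :: "'b::complex_banach_algebra \<Rightarrow> 'a::complex_banach_algebra"
  assumes T: "bounded_complex_linear T" "algebra_hom T"
    and intertwine: "T \<circ> \<tau> = \<theta> \<circ> T"
    and D: "theta_derivation dual_left dual_right \<theta> D"
  shows "theta_derivation dual_left dual_right \<tau> (dual_map T \<circ> D \<circ> T)"
  unfolding theta_derivation_def
proof (intro conjI allI)
  show "bounded_complex_linear (dual_map T \<circ> D \<circ> T)"
    using T D by (auto simp: theta_derivation_def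
        intro!: bounded_complex_linear_compose bounded_complex_linear_dual_map)
  have T_\<tau>: "T (\<tau> f) = \<theta> (T f)" for f
    using intertwine by (rule comp_eq_dest)
  have T_mult: "T (f * g) = T f * T g" for f g
    using T(2) by (simp add: algebra_hom_def)
  have D_mult: "D (a * b) = dual_right (D a) (\<theta> b) + dual_left (\<theta> a) (D b)" for a b
    using D by (simp add: theta_derivation_def)
  show "(dual_map T \<circ> D \<circ> T) (f * g) =
      dual_right ((dual_map T \<circ> D \<circ> T) f) (\<tau> g) + dual_left (\<tau> f) ((dual_map T \<circ> D \<circ> T) g)" for f g
    \<comment> \<open>Tested at \<open>h\<close>, the left term is \<open>D (T g)\<close> at
      \<open>T h * \<theta> (T f)\<close>. Intertwining and multiplicativity rewrite this point as
      \<open>T (h * \<tau> f)\<close>, which is the action of \<open>\<tau> f\<close> on the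
      pulled-back functional. The right term is symmetric.\<close>
    by (rule dual_eqI) (simp add: T(1) T_\<tau> T_mult D_mult)
qed

text \<open>Twisted weak amenability descends to a commutative quotient: pullback of derivations
  along a surjective \<open>T\<close> is injective.\<close>

lemma theta_weakly_amenable_surj_hom:
  fixes T :: "'b::{complex_banach_algebra, comm_ring} \<Rightarrow> 'a::{complex_banach_algebra, comm_ring}"
  assumes T: "bounded_complex_linear T" "algebra_hom T" "surj T"
    and intertwine: "T \<circ> \<tau> = \<theta> \<circ> T"
    and amenable: "theta_weakly_amenable \<tau>"
  shows "theta_weakly_amenable \<theta>"
  unfolding theta_weakly_amenable_def theta_inner_dual_iff_zero
proof (intro allI impI)
  fix D :: "'a \<Rightarrow> 'a dual" and a
  assume "theta_derivation dual_left dual_right \<theta> D"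
  then have zero: "(dual_map T \<circ> D \<circ> T) f = 0" for f
    using theta_derivation_pullback[OF T(1,2) intertwine] amenable
    unfolding theta_weakly_amenable_def theta_inner_dual_iff_zero by blast
  show "D a = 0"
  proof (rule dual_eqI)
    fix b
    \<comment> \<open>Surjectivity enters twice: \<open>f\<close> lifts the argument of
      \<open>D\<close>, and \<open>g\<close> lifts the test vector for the functional
      \<open>D a\<close>.\<close>
    obtain f g where "a = T f" "b = T g"
      using T(3) by (metis surjD)
    then show "dual_apply (D a) b = dual_apply 0 b"
      using dual_map_apply[OF T(1), of "D a" g] zero[of f] by simp
  qed
qed

lemma bounded_complex_linear_eval_at:
  "bounded_complex_linear (eval_at x :: ('x::topological_space \<Rightarrow>\<^sub>C 'a::complex_normed_vector) \<Rightarrow> 'a)"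
  unfolding bounded_complex_linear_def complex_linear_def eval_at_def
  \<comment> \<open>The constant 1 works because evaluation is contractive for the supremum
    norm.\<close>
  by (auto intro!: exI[of _ 1] norm_bounded)

lemma algebra_hom_eval_at:
  "algebra_hom (eval_at x :: ('x::topological_space \<Rightarrow>\<^sub>C 'a::complex_normed_algebra) \<Rightarrow> 'a)"
  by (simp add: algebra_hom_def complex_linear_def eval_at_def)

lemma surj_eval_at:
  "surj (eval_at x :: ('x::topological_space \<Rightarrow>\<^sub>C 'a::metric_space) \<Rightarrow> 'a)"
  by (rule surjI[of _ const_bcontfun]) (simp add: eval_at_def)

theorem theorem3p4:
  fixes \<tau> :: "('x::t2_space \<Rightarrow>\<^sub>C 'a::{complex_banach_algebra, comm_ring}) \<Rightarrow> ('x \<Rightarrow>\<^sub>C 'a)"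
    and x\<^sub>0 :: 'x
  assumes "compact (UNIV :: 'x set)"
    and "algebra_hom \<tau>"
    and "continuous_on UNIV \<tau>"
    and "closure (range \<tau>) = UNIV"
    and "eval_at x\<^sub>0 \<circ> \<tau> = tau_tilde \<tau> x\<^sub>0 \<circ> eval_at x\<^sub>0"
    and "theta_weakly_amenable \<tau>"
  shows "theta_weakly_amenable (tau_tilde \<tau> x\<^sub>0)"
  \<comment> \<open>Here \<open>T\<close> is \<open>eval_at x\<^sub>0\<close> and
    \<open>\<theta>\<close> is \<open>tau_tilde \<tau> x\<^sub>0\<close>.\<close>
  using bounded_complex_linear_eval_at algebra_hom_eval_at surj_eval_at assms(5,6)
  by (rule theta_weakly_amenable_surj_hom)

end
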